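(* Let $G$ be a graph with ${\rm diam}(G)=2$. Then $G$ is a perfect injectively colorable graph if and only if either each edge of $G$ lies in a triangle or there exists a perfect matching $M$ in $G$ such that no edge of $M$ lies in a triangle of $G$.
   Context: All graphs are finite and simple. An injective coloring of $G$ is a partition of $V(G)$ into color classes of a function $f$ on $V(G)$ such that no vertex is adjacent to two distinct vertices $u,w$ with $f(u)=f(w)$. An open packing in $G$ is a set $B\subseteq V(G)$ such that $N_G(u)\cap N_G(v)=\emptyset$ for any two distinct $u,v\in B$. The open packing number $\rho^{\rm o}(G)$ is the maximum cardinality of an open packing in $G$, and a $\rho^{\rm o}(G)$-set is an open packing of cardinality $\rho^{\rm o}(G)$. A graph $G$ is a perfect injectively colorable graph if it has an injective coloring in which every color class is a $\rho^{\rm o}(G)$-set. *)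

theory Defs
  imports "Graph_Theory.Graph_Theory"
begin

text \<open>
  A finite simple graph is a \<^locale>\<open>pair_graph\<close>: a finite, loop-free, symmetric digraph whose arcs
  are pairs of vertices, each undirected edge being represented by its two arcs.
\<close>

definition edges :: "'a pair_pre_digraph \<Rightarrow> 'a set set" where
  "edges G = {{u, v} | u v. (u, v) \<in> parcs G}"

definition nbhd :: "'a pair_pre_digraph \<Rightarrow> 'a \<Rightarrow> 'a set" where
  "nbhd G v = {u \<in> pverts G. (v, u) \<in> parcs G}"

text \<open>
  With unit arc weights the shortest-path cost is the usual distance (\<open>\<infinity>\<close> between different
  components), so a disconnected graph has diameter \<open>\<infinity>\<close>.
\<close>

definition graph_dist :: "'a pair_pre_digraph \<Rightarrow> 'a \<Rightarrow> 'a \<Rightarrow> ereal" where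
  "graph_dist G u v = wf_digraph.\<mu> (with_proj G) (\<lambda>_. 1) u v"

definition diam :: "'a pair_pre_digraph \<Rightarrow> ereal" where
  "diam G = (SUP u \<in> pverts G. SUP v \<in> pverts G. graph_dist G u v)"

definition open_packing :: "'a pair_pre_digraph \<Rightarrow> 'a set \<Rightarrow> bool" where
  "open_packing G B \<longleftrightarrow>
     B \<subseteq> pverts G \<and> (\<forall>u\<in>B. \<forall>v\<in>B. u \<noteq> v \<longrightarrow> nbhd G u \<inter> nbhd G v = {})"

definition open_packing_number :: "'a pair_pre_digraph \<Rightarrow> nat" where
  "open_packing_number G = Max (card ` {B. open_packing G B})"

definition max_open_packing :: "'a pair_pre_digraph \<Rightarrow> 'a set \<Rightarrow> bool" where
  "max_open_packing G B \<longleftrightarrow> open_packing G B \<and> card B = open_packing_number G"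

definition injective_coloring_fun :: "'a pair_pre_digraph \<Rightarrow> ('a \<Rightarrow> 'c) \<Rightarrow> bool" where
  "injective_coloring_fun G f \<longleftrightarrow>
     \<not> (\<exists>v \<in> pverts G. \<exists>u \<in> nbhd G v. \<exists>w \<in> nbhd G v. u \<noteq> w \<and> f u = f w)"

definition color_classes :: "'a pair_pre_digraph \<Rightarrow> ('a \<Rightarrow> 'c) \<Rightarrow> 'a set set" where
  "color_classes G f = {{v \<in> pverts G. f v = c} | c. c \<in> f ` pverts G}"

text \<open>
  Only the partition matters, and on a finite graph every coloring has the same color classes as
  one by natural numbers; so colors are taken in \<^typ>\<open>nat\<close>.
\<close>

definition injective_coloring :: "'a pair_pre_digraph \<Rightarrow> 'a set set \<Rightarrow> bool" where
  "injective_coloring G P \<longleftrightarrow>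
     (\<exists>f :: 'a \<Rightarrow> nat. injective_coloring_fun G f \<and> P = color_classes G f)"

definition perfect_injectively_colorable :: "'a pair_pre_digraph \<Rightarrow> bool" where
  "perfect_injectively_colorable G \<longleftrightarrow>
     (\<exists>P. injective_coloring G P \<and> (\<forall>B\<in>P. max_open_packing G B))"

definition triangle :: "'a pair_pre_digraph \<Rightarrow> 'a set \<Rightarrow> bool" where
  "triangle G T \<longleftrightarrow>
     T \<subseteq> pverts G \<and> card T = 3 \<and> (\<forall>u\<in>T. \<forall>v\<in>T. u \<noteq> v \<longrightarrow> (u, v) \<in> parcs G)"

definition lies_in_triangle :: "'a pair_pre_digraph \<Rightarrow> 'a set \<Rightarrow> bool" where
  "lies_in_triangle G e \<longleftrightarrow> (\<exists>T. triangle G T \<and> e \<subseteq> T)"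

definition perfect_matching :: "'a pair_pre_digraph \<Rightarrow> 'a set set \<Rightarrow> bool" where
  "perfect_matching G M \<longleftrightarrow> M \<subseteq> edges G \<and> pairwise disjnt M \<and> \<Union>M = pverts G"

end

theory Submission
  imports Defs
begin

text \<open>
  In diameter 2, two vertices without a common neighbour are adjacent, so an open packing with two
  elements is exactly an edge outside all triangles, and three pairwise such vertices
  would themselves form a triangle. Hence the open packing number is 1 if every edge lies in a
  triangle, where the partition into singletons works, and 2 otherwise, where the partitions into
  maximum open packings are exactly the perfect matchings by triangle-free edges.
\<close>

context pair_graph
begin

lemma nbhd_iff: "u \<in> nbhd G v \<longleftrightarrow> (v, u) \<in> parcs G"
  by (auto simp: nbhd_def dest: in_arcsD2)

lemma arc_sym: "(u, v) \<in> parcs G \<Longrightarrow> (v, u) \<in> parcs G"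
  using sym_arcs by (auto simp: symmetric_def dest: symD)

text \<open>The third vertex of a triangle on an edge is a common neighbour of its ends, and
  conversely. This translates the triangle condition into the disjointness condition of
  \<open>open_packing\<close>.\<close>

lemma lies_in_triangle_arc_iff:
  assumes "(u, v) \<in> parcs G"
  shows "lies_in_triangle G {u, v} \<longleftrightarrow> nbhd G u \<inter> nbhd G v \<noteq> {}"
proof
  assume "lies_in_triangle G {u, v}"
  then obtain T where T: "triangle G T" "u \<in> T" "v \<in> T"
    by (auto simp: lies_in_triangle_def)
  have "u \<noteq> v" using assms no_loops' by auto
  have "card T = 3" using T by (simp add: triangle_def)
  have "card {u, v} = 2" using \<open>u \<noteq> v\<close> by simp
  have "\<not> T \<subseteq> {u, v}"
    using \<open>card T = 3\<close> \<open>card {u, v} = 2\<close> card_mono[of "{u, v}" T] by auto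
  then obtain w where "w \<in> T" "w \<noteq> u" "w \<noteq> v" by auto
  then have "w \<in> nbhd G u \<inter> nbhd G v"
    using T by (auto simp: nbhd_iff triangle_def)
  then show "nbhd G u \<inter> nbhd G v \<noteq> {}" by auto
next
  assume "nbhd G u \<inter> nbhd G v \<noteq> {}"
  then obtain w where w: "(u, w) \<in> parcs G" "(v, w) \<in> parcs G" by (auto simp: nbhd_iff)
  have "u \<noteq> v" "u \<noteq> w" "v \<noteq> w" using assms w no_loops' by auto
  then have "triangle G {u, v, w}"
    using assms w arc_sym in_arcsD1 in_arcsD2 by (auto simp: triangle_def)
  then show "lies_in_triangle G {u, v}" by (auto simp: lies_in_triangle_def)
qed

lemma graph_dist_le_2D:
  assumes "graph_dist G u v \<le> 2"
  shows "u = v \<or> (u, v) \<in> parcs G \<or> nbhd G u \<inter> nbhd G v \<noteq> {}"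
proof -
  \<comment> \<open>The distance is an infimum of walk costs. A strict bound yields an actual walk
    below it, without showing that the infimum is attained; costs being lengths, below 3 means at
    most 2.\<close>
  have "graph_dist G u v < 3" using assms by (rule order.strict_trans1) simp
  then obtain p where p: "awalk u p v" "ereal (awalk_cost (\<lambda>_. 1) p) < 3"
    by (auto simp: graph_dist_def \<mu>_def INF_less_iff)
  have "awalk_cost (\<lambda>_. 1) p = length p" by (induction p) auto
  with p have "length p < 3" by (cases "length p < 3") auto
  then consider "p = []" | a where "p = [a]" | a b where "p = [a, b]"
    \<comment> \<open>The rule serves only to split lists into empty, singleton and longer
      ones.\<close>
    by (cases p rule: remdups_adj.cases) (auto simp: less_Suc_eq numeral_3_eq_3)
  then show ?thesis
  proof cases
    case 1
    then show ?thesis using p by (auto simp: awalk_Nil_iff)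
  next
    case 2
    then show ?thesis using p by (cases a) (auto simp: awalk_Cons_iff awalk_Nil_iff)
  next
    case 3
    then obtain w where "(u, w) \<in> parcs G" "(w, v) \<in> parcs G"
      using p by (cases a; cases b) (auto simp: awalk_Cons_iff awalk_Nil_iff)
    then show ?thesis using arc_sym by (auto simp: nbhd_iff)
  qed
qed

section \<open>Open packings and the colorings built from them\<close>

lemma finite_open_packings: "finite {B. open_packing G B}"
  by (rule finite_subset[of _ "Pow (pverts G)"]) (auto simp: open_packing_def)

lemma card_le_open_packing_number:
  "open_packing G B \<Longrightarrow> card B \<le> open_packing_number G"
  using finite_open_packings by (auto simp: open_packing_number_def intro!: Max_ge)

lemma open_packing_attaining_number:
  obtains B where "open_packing G B" "card B = open_packing_number G"
proof -
  \<comment> \<open>The empty packing makes the set under \<open>Max\<close> nonempty, so that the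
    maximum is attained.\<close>
  have "open_packing G {}" by (simp add: open_packing_def)
  then have "open_packing_number G \<in> card ` {B. open_packing G B}"
    unfolding open_packing_number_def using finite_open_packings by (intro Max_in) auto
  then show ?thesis using that by auto
qed

lemma open_packing_singleton: "v \<in> pverts G \<Longrightarrow> open_packing G {v}"
  by (simp add: open_packing_def)

lemma open_packing_arc:
  assumes "(u, v) \<in> parcs G" "\<not> lies_in_triangle G {u, v}"
  shows "open_packing G {u, v}"
  using assms lies_in_triangle_arc_iff[OF assms(1)] in_arcsD1 in_arcsD2
  by (auto simp: open_packing_def)

text \<open>Giving all vertices different colors is an injective coloring, and its singleton classes
  have the maximum size 1.\<close>

lemma perfect_injectively_colorable_if_singletons:
  assumes "open_packing_number G = 1"
  shows "perfect_injectively_colorable G"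
proof -
  obtain f :: "'a \<Rightarrow> nat" where f: "inj_on f (pverts G)"
    using finite_imp_inj_to_nat_seg[OF finite_verts] by auto
  have "injective_coloring_fun G f"
    using f by (auto simp: injective_coloring_fun_def nbhd_def dest: inj_onD)
  moreover have "max_open_packing G B" if "B \<in> color_classes G f" for B
  proof -
    obtain v where v: "v \<in> pverts G" "B = {u \<in> pverts G. f u = f v}"
      using \<open>B \<in> color_classes G f\<close> by (auto simp: color_classes_def)
    then have "B = {v}" using f by (auto dest: inj_onD)
    then show ?thesis
      using assms open_packing_singleton v(1) by (simp add: max_open_packing_def)
  qed
  ultimately show ?thesis
    by (auto simp: perfect_injectively_colorable_def injective_coloring_def)
qed

text \<open>Each vertex is colored by its matching edge. The ends of such an edge share a color, but
  no neighbour, since the edge lies in no triangle.\<close>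

lemma perfect_injectively_colorable_if_matching:
  assumes "open_packing_number G = 2" "perfect_matching G M"
    and M: "\<forall>e \<in> M. \<not> lies_in_triangle G e"
  shows "perfect_injectively_colorable G"
proof -
  have ME: "M \<subseteq> edges G" and disj: "pairwise disjnt M" and cover: "\<Union>M = pverts G"
    using assms(2) by (auto simp: perfect_matching_def)
  have "finite M" using cover finite_verts by (auto intro: finite_UnionD)
  then obtain g :: "'a set \<Rightarrow> nat" where g: "inj_on g M"
    by (meson finite_imp_inj_to_nat_seg)
  \<comment> \<open>The edge of \<open>M\<close> at \<open>v\<close> exists because \<open>M\<close>
    covers the vertices and is unique because \<open>M\<close> is disjoint; \<open>g\<close> encodes
    it as a natural number.\<close>
  define f where "f v = g (THE e. e \<in> M \<and> v \<in> e)" for v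
  have f: "f v = g e" if "e \<in> M" "v \<in> e" for e v
  proof -
    have "(THE e. e \<in> M \<and> v \<in> e) = e"
      using that disj by (intro the_equality) (auto simp: pairwise_def disjnt_iff)
    then show ?thesis by (simp add: f_def)
  qed
  have class_eq: "{u \<in> pverts G. f u = f v} = e" if "e \<in> M" "v \<in> e" for e v
  proof -
    have "u \<in> e" if u: "u \<in> pverts G" "f u = f v" for u
    proof -
      obtain e' where e': "e' \<in> M" "u \<in> e'" using u cover by auto
      then have "g e' = g e" using u(2) f \<open>e \<in> M\<close> \<open>v \<in> e\<close> by metis
      then show ?thesis using g e' \<open>e \<in> M\<close> by (auto dest: inj_onD)
    qed
    then show ?thesis using that cover f by auto
  qed
  have "injective_coloring_fun G f"
    unfolding injective_coloring_fun_def
  \<comment> \<open>Distinct neighbours \<open>u\<close>, \<open>w\<close> of \<open>v\<close> with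
    equal color would form an edge of \<open>M\<close>, and \<open>v\<close> would complete it to a
    triangle.\<close>
  proof (clarify)
    fix v u w assume H: "u \<in> nbhd G v" "w \<in> nbhd G v" "u \<noteq> w" "f u = f w"
    then have "u \<in> pverts G" "w \<in> pverts G" by (auto simp: nbhd_def)
    then obtain e where e: "e \<in> M" "u \<in> e" using cover by auto
    then have "w \<in> e" using class_eq[OF e] H \<open>w \<in> pverts G\<close> by auto
    obtain a b where ab: "e = {a, b}" "(a, b) \<in> parcs G" using e ME by (auto simp: edges_def)
    then have "(u, w) \<in> parcs G" "e = {u, w}"
      using e \<open>w \<in> e\<close> H(3) arc_sym by auto
    moreover have "v \<in> nbhd G u \<inter> nbhd G w" using H arc_sym by (auto simp: nbhd_iff)
    ultimately show False using M e lies_in_triangle_arc_iff by blast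
  qed
  moreover have "max_open_packing G B" if B: "B \<in> color_classes G f" for B
  proof -
    obtain v where v: "v \<in> pverts G" "B = {u \<in> pverts G. f u = f v}"
      using B by (auto simp: color_classes_def)
    then obtain e where e: "e \<in> M" "v \<in> e" using cover by auto
    with v have "B = e" using class_eq by auto
    obtain a b where ab: "e = {a, b}" "(a, b) \<in> parcs G" using e ME by (auto simp: edges_def)
    then have "open_packing G e" using open_packing_arc M e by auto
    moreover have "card e = 2" using ab no_loops' by (auto simp: card_insert_if)
    ultimately show ?thesis using \<open>B = e\<close> assms(1) by (simp add: max_open_packing_def)
  qed
  ultimately show ?thesis
    by (auto simp: perfect_injectively_colorable_def injective_coloring_def)
qed

end

section \<open>Open packings in graphs of diameter 2\<close>

locale pair_graph_diam2 = pair_graph +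
  assumes diam2: "diam G = 2"
begin

lemma adjacent_or_common_nbhd:
  assumes "u \<in> pverts G" "v \<in> pverts G" "u \<noteq> v"
  shows "(u, v) \<in> parcs G \<or> nbhd G u \<inter> nbhd G v \<noteq> {}"
proof -
  have "graph_dist G u v \<le> (SUP v \<in> pverts G. graph_dist G u v)"
    using assms(2) by (rule SUP_upper)
  also have "\<dots> \<le> diam G" unfolding diam_def using assms(1) by (rule SUP_upper)
  finally show ?thesis using graph_dist_le_2D[of u v] assms(3) diam2 by auto
qed

lemma verts_nonempty: "pverts G \<noteq> {}"
proof
  assume "pverts G = {}"
  \<comment> \<open>A supremum over the empty set in \<open>ereal\<close> is the bottom
    element.\<close>
  then have "diam G = -\<infinity>" by (simp add: diam_def bot_ereal_def)
  with diam2 show False by simp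
qed

lemma open_packing_pairD:
  assumes "open_packing G B" "u \<in> B" "v \<in> B" "u \<noteq> v"
  shows "(u, v) \<in> parcs G" "\<not> lies_in_triangle G {u, v}" "B = {u, v}"
proof -
  have arc: "(x, y) \<in> parcs G" and empty: "nbhd G x \<inter> nbhd G y = {}"
    if "x \<in> B" "y \<in> B" "x \<noteq> y" for x y
    using assms(1) that adjacent_or_common_nbhd[of x y] by (auto simp: open_packing_def)
  show "(u, v) \<in> parcs G" using arc assms by auto
  then show "\<not> lies_in_triangle G {u, v}"
    using lies_in_triangle_arc_iff empty assms by auto
  \<comment> \<open>A third element would be adjacent to both \<open>u\<close> and \<open>v\<close>,
    hence itself a forbidden common neighbour.\<close>
  have False if "w \<in> B" "w \<noteq> u" "w \<noteq> v" for w
  proof -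
    have "w \<in> nbhd G u \<inter> nbhd G v" using arc assms that by (simp add: nbhd_iff)
    then show False using empty assms by auto
  qed
  then show "B = {u, v}" using assms by auto
qed

lemma open_packing_number_eq:
  "open_packing_number G = (if \<forall>e \<in> edges G. lies_in_triangle G e then 1 else 2)"
proof -
  obtain v where "v \<in> pverts G" using verts_nonempty by auto
  \<comment> \<open>Singleton packings give this bound, which excludes an empty maximum packing
    below.\<close>
  then have ge1: "1 \<le> open_packing_number G"
    using card_le_open_packing_number[OF open_packing_singleton] by fastforce
  obtain B where B: "open_packing G B" "card B = open_packing_number G"
    by (rule open_packing_attaining_number)
  have B_cases: "card B = 1 \<or> (\<exists>u v. u \<noteq> v \<and> u \<in> B \<and> v \<in> B \<and> card B = 2)"
  proof (cases "\<exists>u v. u \<noteq> v \<and> u \<in> B \<and> v \<in> B")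
    case True
    then obtain u v where "u \<noteq> v" "u \<in> B" "v \<in> B" by auto
    moreover have "B = {u, v}" using open_packing_pairD(3) B calculation by blast
    ultimately show ?thesis by (auto simp: card_insert_if)
  next
    case False
    moreover have "B \<noteq> {}" using B(2) ge1 by auto
    ultimately obtain x where "B = {x}" by blast
    then show ?thesis by simp
  qed
  show ?thesis
  proof (cases "\<forall>e \<in> edges G. lies_in_triangle G e")
    case True
    then have "card B = 1"
      using B_cases open_packing_pairD(1,2)[OF B(1)] unfolding edges_def by blast
    with True B show ?thesis by simp
  next
    case False
    then obtain a b where ab: "(a, b) \<in> parcs G" "\<not> lies_in_triangle G {a, b}"
      by (auto simp: edges_def)
    then have "a \<noteq> b" using no_loops' by auto
    then have "2 \<le> open_packing_number G"
      using card_le_open_packing_number[OF open_packing_arc[OF ab]] by simp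
    with False B B_cases show ?thesis by auto
  qed
qed

text \<open>Each class is an open packing of size 2, hence an edge outside all triangles by
  \<open>open_packing_pairD\<close>; disjointness and covering hold because color classes partition
  the vertices.\<close>

lemma color_classes_perfect_matching:
  assumes "open_packing_number G = 2" "\<forall>B \<in> color_classes G f. max_open_packing G B"
  shows "perfect_matching G (color_classes G f) \<and>
    (\<forall>e \<in> color_classes G f. \<not> lies_in_triangle G e)"
proof -
  have "B \<in> edges G \<and> \<not> lies_in_triangle G B" if "B \<in> color_classes G f" for B
  proof -
    have B: "open_packing G B" "card B = 2"
      using assms that by (auto simp: max_open_packing_def)
    then obtain u v where uv: "B = {u, v}" "u \<noteq> v" by (auto simp: card_2_iff)
    then show ?thesis using open_packing_pairD(1,2)[OF B(1), of u v] by (auto simp: edges_def)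
  qed
  moreover have "pairwise disjnt (color_classes G f)"
    by (auto simp: pairwise_def disjnt_iff color_classes_def)
  moreover have "\<Union>(color_classes G f) = pverts G"
    by (auto simp: color_classes_def)
  ultimately show ?thesis by (auto simp: perfect_matching_def)
qed

end

theorem proposition13:
  fixes G :: "'a pair_pre_digraph"
  assumes "pair_graph G"
    and "diam G = 2"
  shows "perfect_injectively_colorable G \<longleftrightarrow>
    (\<forall>e \<in> edges G. lies_in_triangle G e) \<or>
    (\<exists>M. perfect_matching G M \<and> (\<forall>e \<in> M. \<not> lies_in_triangle G e))"
proof -
  interpret pair_graph_diam2 G
    using assms by (intro pair_graph_diam2.intro pair_graph_diam2_axioms.intro)
  show ?thesis
  proof (cases "\<forall>e \<in> edges G. lies_in_triangle G e")
    case True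
    then show ?thesis
      using perfect_injectively_colorable_if_singletons open_packing_number_eq by simp
  next
    case False
    then have two: "open_packing_number G = 2" using open_packing_number_eq by simp
    \<comment> \<open>From left to right, the color classes themselves serve as
      \<open>M\<close>.\<close>
    have "perfect_injectively_colorable G \<longleftrightarrow>
        (\<exists>M. perfect_matching G M \<and> (\<forall>e \<in> M. \<not> lies_in_triangle G e))"
      using perfect_injectively_colorable_if_matching[OF two] color_classes_perfect_matching[OF two]
      unfolding perfect_injectively_colorable_def[of G] injective_coloring_def by blast
    with False show ?thesis by blast
  qed
qed

end
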